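(* Let $\mathcal{X}$ and $\mathcal{Y}$ be closed convex sets, $\mathcal{Z}=\mathcal{X}\times\mathcal{Y}$, and let $f=\frac1n\sum_{i=1}^n f_i:\mathcal{Z}\to\mathbb{R}$, where each $f_i(\mathbf{x},\mathbf{y})$ is differentiable, convex in $\mathbf{x}$ and concave in $\mathbf{y}$. Assume that $f$ is $(\mu,\mu)$-convex-concave with $\mu>0$ and that $\{f_i\}_{i=1}^n$ is $L$-average smooth. Let $\mathbf{z}^*=(\mathbf{x}^*,\mathbf{y}^* )$ be the saddle point of $\min_{\mathbf{x}\in\mathcal{X}}\max_{\mathbf{y}\in\mathcal{Y}}f(\mathbf{x},\mathbf{y})$. Then the iterates $\mathbf{z}_k$ of the algorithm L-SVRE (defined in the context), started from $\mathbf{z}_0\in\mathcal{Z}$ with probability parameter $p=1/(2n)$ and stepsize $\tau=1/(4\sqrt{n}L)$, satisfy for every iteration $k$ $$\mathbb{E}\|\mathbf{z}_k-\mathbf{z}^*\|_2^2\le 4\|\mathbf{z}_0-\mathbf{z}^*\|_2^2\left(1-\frac{1}{4(n+2\sqrt{n}L/\mu)}\right)^k.$$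
   Context: Average smoothness: differentiable functions $\{f_i\}_{i=1}^n$ on $\mathcal{Z}$ are $L$-average smooth if $\frac1n\sum_{i=1}^n\|\nabla f_i(\mathbf{z})-\nabla f_i(\mathbf{z}')\|_2^2\le L^2\|\mathbf{z}-\mathbf{z}'\|_2^2$ for all $\mathbf{z},\mathbf{z}'\in\mathcal{Z}$. $f$ is $(\mu_x,\mu_y)$-convex-concave if $f(\cdot,\mathbf{y})$ is $\mu_x$-strongly convex for every $\mathbf{y}$ and $f(\mathbf{x},\cdot)$ is $\mu_y$-strongly concave for every $\mathbf{x}$. Gradient operators: $\mathbf{g}(\mathbf{z})=(\nabla_{\mathbf{x}}f(\mathbf{z}),-\nabla_{\mathbf{y}}f(\mathbf{z}))$ and $\mathbf{g}_i(\mathbf{z})=(\nabla_{\mathbf{x}}f_i(\mathbf{z}),-\nabla_{\mathbf{y}}f_i(\mathbf{z}))$. $\mathcal{P}_{\mathcal{Z}}$ is the Euclidean projection onto $\mathcal{Z}$. Algorithm L-SVRE (inputs $\{f_i\}_{i=1}^n$, $\mathbf{z}_0=(\mathbf{x}_0,\mathbf{y}_0)$, $\tau$, $p$, $T$). Set $\alpha=1-p$ and $\mathbf{w}_0=\mathbf{z}_0$. For $k=0,1,\dots,T-1$: (1) $\bar{\mathbf{z}}_k=\alpha\mathbf{z}_k+(1-\alpha)\mathbf{w}_k$; (2) $\mathbf{z}_{k+1/2}=\mathcal{P}_{\mathcal{Z}}(\bar{\mathbf{z}}_k-\tau\mathbf{g}(\mathbf{w}_k))$; (3) draw an index $i\in\{1,\dots,n\}$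 uniformly at random; (4) $\mathbf{z}_{k+1}=\mathcal{P}_{\mathcal{Z}}(\bar{\mathbf{z}}_k-\tau[\mathbf{g}(\mathbf{w}_k)+\mathbf{g}_i(\mathbf{z}_{k+1/2})-\mathbf{g}_i(\mathbf{w}_k)])$; (5) $\mathbf{w}_{k+1}=\mathbf{z}_{k+1}$ with probability $p$, and $\mathbf{w}_{k+1}=\mathbf{w}_k$ with probability $1-p$. Output $(\mathbf{x}_T,\mathbf{y}_T)=\mathbf{z}_T$. All random choices are independent. *)

theory Defs
  imports "HOL-Probability.Probability"
begin

text \<open>
  The gradient is taken relative to the domain \<open>S\<close>, so that functions given on \<open>S\<close> only
  (one-sided derivatives on the boundary) are covered. A vector field \<open>G\<close> with this property
  exists iff \<open>f differentiable_on S\<close>. If \<open>S\<close> has empty interior, \<open>G\<close> need not be unique.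
\<close>

definition gradient_on :: "'c::euclidean_space set \<Rightarrow> ('c \<Rightarrow> real) \<Rightarrow> ('c \<Rightarrow> 'c) \<Rightarrow> bool" where
  "gradient_on S f G \<longleftrightarrow> (\<forall>z\<in>S. (f has_derivative (\<lambda>h. G z \<bullet> h)) (at z within S))"

definition average_smooth ::
  "real \<Rightarrow> nat \<Rightarrow> 'c::euclidean_space set \<Rightarrow> (nat \<Rightarrow> 'c \<Rightarrow> 'c) \<Rightarrow> bool" where
  "average_smooth L n S G \<longleftrightarrow>
     (\<forall>z\<in>S. \<forall>z'\<in>S. (1 / real n) * (\<Sum>i=1..n. (norm (G i z - G i z'))\<^sup>2) \<le> L\<^sup>2 * (norm (z - z'))\<^sup>2)"

definition strongly_convex_on :: "real \<Rightarrow> 'a::euclidean_space set \<Rightarrow> ('a \<Rightarrow> real) \<Rightarrow> bool" where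
  "strongly_convex_on \<mu> S f \<longleftrightarrow>
     convex S \<and>
     (\<forall>x\<in>S. \<forall>y\<in>S. \<forall>t\<in>{0..1}.
        f (t *\<^sub>R x + (1 - t) *\<^sub>R y)
          \<le> t * f x + (1 - t) * f y - \<mu> / 2 * t * (1 - t) * (norm (x - y))\<^sup>2)"

definition strongly_concave_on :: "real \<Rightarrow> 'a::euclidean_space set \<Rightarrow> ('a \<Rightarrow> real) \<Rightarrow> bool" where
  "strongly_concave_on \<mu> S f \<longleftrightarrow> strongly_convex_on \<mu> S (\<lambda>x. - f x)"

definition convex_concave_on ::
  "real \<Rightarrow> real \<Rightarrow> 'a::euclidean_space set \<Rightarrow> 'b::euclidean_space set \<Rightarrow> ('a \<times> 'b \<Rightarrow> real) \<Rightarrow> bool" where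
  "convex_concave_on \<mu>x \<mu>y X Y f \<longleftrightarrow>
     (\<forall>y\<in>Y. strongly_convex_on \<mu>x X (\<lambda>x. f (x, y))) \<and>
     (\<forall>x\<in>X. strongly_concave_on \<mu>y Y (\<lambda>y. f (x, y)))"

definition saddle_point :: "'a set \<Rightarrow> 'b set \<Rightarrow> ('a \<times> 'b \<Rightarrow> real) \<Rightarrow> 'a \<times> 'b \<Rightarrow> bool" where
  "saddle_point X Y f z \<longleftrightarrow>
     (case z of (xs, ys) \<Rightarrow> xs \<in> X \<and> ys \<in> Y \<and>
        (\<forall>x\<in>X. \<forall>y\<in>Y. f (xs, y) \<le> f (xs, ys) \<and> f (xs, ys) \<le> f (x, ys)))"

text \<open>
  The two components of a gradient of \<open>f\<close> on \<open>'a \<times> 'b\<close> are the partial gradients of \<open>f\<close>.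
\<close>

definition gradient_operator ::
  "('a::euclidean_space \<times> 'b::euclidean_space \<Rightarrow> 'a \<times> 'b) \<Rightarrow> 'a \<times> 'b \<Rightarrow> 'a \<times> 'b" where
  "gradient_operator G z = (fst (G z), - snd (G z))"

text \<open>
  One iteration of L-SVRE, as the conditional law of \<open>(z\<^bsub>k+1\<^esub>, w\<^bsub>k+1\<^esub>)\<close> given \<open>(z\<^sub>k, w\<^sub>k)\<close>. Iterating
  the kernel makes the random choices of all iterations independent.
\<close>

definition lsvre_step ::
  "'c::euclidean_space set \<Rightarrow> nat \<Rightarrow> ('c \<Rightarrow> 'c) \<Rightarrow> (nat \<Rightarrow> 'c \<Rightarrow> 'c) \<Rightarrow> real \<Rightarrow> real \<Rightarrow>
   'c \<times> 'c \<Rightarrow> ('c \<times> 'c) pmf" where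
  "lsvre_step Z n g gi \<tau> p = (\<lambda>(z, w).
     let \<alpha> = 1 - p;
         zbar = \<alpha> *\<^sub>R z + (1 - \<alpha>) *\<^sub>R w;
         zhalf = closest_point Z (zbar - \<tau> *\<^sub>R g w)
     in do {
          i \<leftarrow> pmf_of_set {1..n};
          let znext = closest_point Z (zbar - \<tau> *\<^sub>R (g w + gi i zhalf - gi i w));
          b \<leftarrow> bernoulli_pmf p;
          return_pmf (znext, if b then znext else w)
        })"

text \<open>The joint law of \<open>(z\<^sub>k, w\<^sub>k)\<close>; it does not depend on the total number of iterations.\<close>

primrec lsvre ::
  "'c::euclidean_space set \<Rightarrow> nat \<Rightarrow> ('c \<Rightarrow> 'c) \<Rightarrow> (nat \<Rightarrow> 'c \<Rightarrow> 'c) \<Rightarrow> real \<Rightarrow> real \<Rightarrow> 'c \<Rightarrow>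
   nat \<Rightarrow> ('c \<times> 'c) pmf" where
  "lsvre Z n g gi \<tau> p z0 0 = return_pmf (z0, z0)"
| "lsvre Z n g gi \<tau> p z0 (Suc k) = bind_pmf (lsvre Z n g gi \<tau> p z0 k) (lsvre_step Z n g gi \<tau> p)"

end

theory Submission
  imports Defs
begin

text \<open>
  Put \<open>s = \<tau> * \<mu>\<close>. The obtuse angle inequalities of the two projections, averaged over the sampled
  index, bound \<open>E \<parallel>z\<^bsub>k+1\<^esub> - z*\<parallel>\<^sup>2\<close> by \<open>(1-p) \<parallel>z\<^sub>k - z*\<parallel>\<^sup>2 + p \<parallel>w\<^sub>k - z*\<parallel>\<^sup>2\<close> minus multiples of
  \<open>\<parallel>h - z*\<parallel>\<^sup>2\<close>, \<open>\<parallel>h - z\<^sub>k\<parallel>\<^sup>2\<close> and \<open>\<parallel>h - w\<^sub>k\<parallel>\<^sup>2\<close>, where \<open>h\<close> is the half step; the variance of the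
  gradient estimate is absorbed because \<open>\<tau>\<^sup>2 L\<^sup>2 \<le> p/2\<close>. Hence the potential
  \<open>(1-p) \<parallel>z - z*\<parallel>\<^sup>2 + \<parallel>w - z*\<parallel>\<^sup>2\<close> contracts in expectation by the factor \<open>1 - p s / (2 (p + s))\<close>,
  which is the claimed rate. Initially the potential is \<open>(2-p) \<parallel>z\<^sub>0 - z*\<parallel>\<^sup>2\<close>, and
  \<open>2 - p \<le> 4 (1-p)\<close> as \<open>p \<le> 1/2\<close>.

  The gradients of the \<open>f\<^sub>i\<close> and of \<open>f\<close> need not be unique, so \<open>Gf\<close> may differ from the average
  of the \<open>G i\<close>. They agree on differences of points of the domain, and only such inner products occur.
\<close>

section \<open>Gradients relative to a convex domain\<close>

lemma gradient_on_directional_limit: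
  assumes "gradient_on S f G" and "convex S" and "z \<in> S" and "u \<in> S"
  shows "((\<lambda>t. (f (z + t *\<^sub>R (u - z)) - f z) / t) \<longlongrightarrow> G z \<bullet> (u - z)) (at_right 0)"
proof -
  let ?c = "\<lambda>t::real. z + t *\<^sub>R (u - z)"
  \<comment> \<open>By convexity the segment from \<open>z\<close> to \<open>u\<close> stays in
    \<open>S\<close>, so the chain rule applies to the derivative within \<open>S\<close> even at
    boundary points.\<close>
  have "?c t = (1 - t) *\<^sub>R z + t *\<^sub>R u" for t
    by (simp add: algebra_simps)
  then have img: "?c ` {0..1} \<subseteq> S"
    using assms(2-4) by (auto simp: convex_alt)
  have "(f has_derivative (\<lambda>h. G z \<bullet> h)) (at (?c 0) within ?c ` {0..1})"
    using assms(1,3) img by (auto simp: gradient_on_def intro: has_derivative_subset)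
  moreover have "(?c has_derivative (\<lambda>t. t *\<^sub>R (u - z))) (at 0 within {0..1})"
    by (auto intro!: derivative_eq_intros)
  ultimately have "((f \<circ> ?c) has_derivative (\<lambda>h. G z \<bullet> h) \<circ> (\<lambda>t. t *\<^sub>R (u - z))) (at 0 within {0..1})"
    by (rule diff_chain_within[rotated])
  then have "((\<lambda>t. f (?c t)) has_real_derivative G z \<bullet> (u - z)) (at 0 within {0..1})"
    by (simp add: has_field_derivative_def o_def mult_commute_abs)
  then have "((\<lambda>t. (f (?c t) - f z) / t) \<longlongrightarrow> G z \<bullet> (u - z)) (at 0 within {0..1})"
    by (simp add: has_field_derivative_iff)
  then show ?thesis
    by (simp add: at_within_Icc_at_right)
qed

text \<open>Pairings with feasible directions are one-sided directional derivatives and hence depend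
  on \<open>f\<close> alone. The direction \<open>u - v\<close> splits into the feasible directions
  \<open>u - z\<close> and \<open>v - z\<close>.\<close>

lemma gradient_on_unique:
  assumes "gradient_on S f G" and "gradient_on S f G'" and "convex S"
    and "z \<in> S" and "u \<in> S" and "v \<in> S"
  shows "G z \<bullet> (u - v) = G' z \<bullet> (u - v)"
proof -
  have "G z \<bullet> (x - z) = G' z \<bullet> (x - z)" if "x \<in> S" for x
    using gradient_on_directional_limit[OF assms(1,3,4) that]
      gradient_on_directional_limit[OF assms(2,3,4) that]
    by (rule tendsto_unique[rotated]) simp
  from this[OF assms(5)] this[OF assms(6)] show ?thesis
    by (simp add: inner_diff_right)
qed

lemma gradient_on_average:
  assumes "\<And>i. i \<in> I \<Longrightarrow> gradient_on S (F i) (G i)"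
    and "\<And>z. z \<in> S \<Longrightarrow> f z = c * (\<Sum>i\<in>I. F i z)"
  shows "gradient_on S f (\<lambda>z. c *\<^sub>R (\<Sum>i\<in>I. G i z))"
  unfolding gradient_on_def
proof
  fix z assume z: "z \<in> S"
  have "((\<lambda>z. c * (\<Sum>i\<in>I. F i z)) has_derivative (\<lambda>h. c * (\<Sum>i\<in>I. G i z \<bullet> h))) (at z within S)"
    using assms(1) z
    by (intro has_derivative_mult_right has_derivative_sum) (auto simp: gradient_on_def)
  then have "(f has_derivative (\<lambda>h. c * (\<Sum>i\<in>I. G i z \<bullet> h))) (at z within S)"
    by (rule has_derivative_transform[OF z, rotated]) (simp add: assms(2))
  then show "(f has_derivative (\<lambda>h. (c *\<^sub>R (\<Sum>i\<in>I. G i z)) \<bullet> h)) (at z within S)"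
    by (simp add: inner_sum_left)
qed

section \<open>First-order and growth inequalities from strong convexity\<close>

lemma strongly_convex_on_gradient:
  assumes "strongly_convex_on \<mu> S f" and "gradient_on S f G" and "x \<in> S" and "y \<in> S"
  shows "f x + G x \<bullet> (y - x) + \<mu> / 2 * (norm (y - x))\<^sup>2 \<le> f y"
proof -
  let ?q = "\<lambda>t. (f (x + t *\<^sub>R (y - x)) - f x) / t"
  have conv: "convex S"
    using assms(1) by (simp add: strongly_convex_on_def)
  \<comment> \<open>Strong convexity on the segment, divided by \<open>t\<close>; as
    \<open>t\<close> tends to 0 from the right, the quotient tends to the directional
    derivative.\<close>
  have "?q t \<le> f y - f x - \<mu> / 2 * (1 - t) * (norm (y - x))\<^sup>2" if "t \<in> {0<..<1}" for t
  proof -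
    have "f (t *\<^sub>R y + (1 - t) *\<^sub>R x)
        \<le> t * f y + (1 - t) * f x - \<mu> / 2 * t * (1 - t) * (norm (y - x))\<^sup>2"
      using assms(1,3,4) that by (auto simp: strongly_convex_on_def)
    moreover have "t *\<^sub>R y + (1 - t) *\<^sub>R x = x + t *\<^sub>R (y - x)"
      by (simp add: algebra_simps)
    ultimately have "f (x + t *\<^sub>R (y - x)) - f x
        \<le> (f y - f x - \<mu> / 2 * (1 - t) * (norm (y - x))\<^sup>2) * t"
      by (simp add: algebra_simps)
    then show ?thesis
      using that by (simp add: divide_le_eq)
  qed
  then have "\<forall>\<^sub>F t in at_right 0. ?q t \<le> f y - f x - \<mu> / 2 * (1 - t) * (norm (y - x))\<^sup>2"
    using eventually_at_right_real[of 0 1] by (auto elim: eventually_mono)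
  moreover have "((\<lambda>t. f y - f x - \<mu> / 2 * (1 - t) * (norm (y - x))\<^sup>2)
      \<longlongrightarrow> f y - f x - \<mu> / 2 * (1 - 0) * (norm (y - x))\<^sup>2) (at_right 0)"
    by (intro tendsto_intros)
  ultimately have "G x \<bullet> (y - x) \<le> f y - f x - \<mu> / 2 * (1 - 0) * (norm (y - x))\<^sup>2"
    using gradient_on_directional_limit[OF assms(2) conv assms(3,4)]
    by (intro tendsto_le[OF trivial_limit_at_right_real])
  then show ?thesis
    by simp
qed

text \<open>Minimality bounds \<open>f\<close> from below on the segment towards \<open>y\<close>,
  strong convexity bounds it from above. Dividing by \<open>t\<close> and letting \<open>t\<close>
  tend to 0 gives quadratic growth without any derivative.\<close>

lemma strongly_convex_on_minimum:
  assumes "strongly_convex_on \<mu> S f" and "x \<in> S" and "y \<in> S" and "\<And>u. u \<in> S \<Longrightarrow> f x \<le> f u"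
  shows "f x + \<mu> / 2 * (norm (y - x))\<^sup>2 \<le> f y"
proof -
  have "\<mu> / 2 * (1 - t) * (norm (y - x))\<^sup>2 \<le> f y - f x" if "t \<in> {0<..<1}" for t
  proof -
    have "t *\<^sub>R y + (1 - t) *\<^sub>R x \<in> S"
      using assms(1-3) that by (auto simp: strongly_convex_on_def intro: convexD)
    then have "f x \<le> f (t *\<^sub>R y + (1 - t) *\<^sub>R x)"
      by (rule assms(4))
    also have "\<dots> \<le> t * f y + (1 - t) * f x - \<mu> / 2 * t * (1 - t) * (norm (y - x))\<^sup>2"
      using assms(1-3) that by (auto simp: strongly_convex_on_def)
    finally have "t * (\<mu> / 2 * (1 - t) * (norm (y - x))\<^sup>2) \<le> t * (f y - f x)"
      by (simp add: algebra_simps)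
    then show ?thesis
      using that by simp
  qed
  then have "\<forall>\<^sub>F t in at_right 0. \<mu> / 2 * (1 - t) * (norm (y - x))\<^sup>2 \<le> f y - f x"
    using eventually_at_right_real[of 0 1] by (auto elim: eventually_mono)
  moreover have "((\<lambda>t. \<mu> / 2 * (1 - t) * (norm (y - x))\<^sup>2)
      \<longlongrightarrow> \<mu> / 2 * (1 - 0) * (norm (y - x))\<^sup>2) (at_right 0)"
    by (intro tendsto_intros)
  ultimately have "\<mu> / 2 * (1 - 0) * (norm (y - x))\<^sup>2 \<le> f y - f x"
    by (intro tendsto_upperbound) auto
  then show ?thesis
    by simp
qed

section \<open>Partial gradients and the saddle operator\<close>

lemma gradient_on_partial_fst:
  assumes "gradient_on (X \<times> Y) f G" and "y \<in> Y"
  shows "gradient_on X (\<lambda>x. f (x, y)) (\<lambda>x. fst (G (x, y)))"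
  unfolding gradient_on_def
proof
  fix x assume x: "x \<in> X"
  have "(f has_derivative (\<lambda>h. G (x, y) \<bullet> h)) (at (x, y) within (\<lambda>x. (x, y)) ` X)"
    using assms x by (auto simp: gradient_on_def intro: has_derivative_subset)
  moreover have "((\<lambda>x. (x, y)) has_derivative (\<lambda>h. (h, 0))) (at x within X)"
    by (auto intro!: derivative_eq_intros)
  ultimately have "(f \<circ> (\<lambda>x. (x, y)) has_derivative (\<lambda>h. G (x, y) \<bullet> h) \<circ> (\<lambda>h. (h, 0))) (at x within X)"
    by (rule diff_chain_within[rotated])
  then show "((\<lambda>x. f (x, y)) has_derivative (\<lambda>h. fst (G (x, y)) \<bullet> h)) (at x within X)"
    by (simp add: o_def inner_prod_def)
qed

lemma gradient_on_partial_snd: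
  assumes "gradient_on (X \<times> Y) f G" and "x \<in> X"
  shows "gradient_on Y (\<lambda>y. f (x, y)) (\<lambda>y. snd (G (x, y)))"
  unfolding gradient_on_def
proof
  fix y assume y: "y \<in> Y"
  have "(f has_derivative (\<lambda>h. G (x, y) \<bullet> h)) (at (x, y) within Pair x ` Y)"
    using assms y by (auto simp: gradient_on_def intro: has_derivative_subset)
  moreover have "(Pair x has_derivative (\<lambda>h. (0, h))) (at y within Y)"
    by (auto intro!: derivative_eq_intros)
  ultimately have "(f \<circ> Pair x has_derivative (\<lambda>h. G (x, y) \<bullet> h) \<circ> (\<lambda>h. (0, h))) (at y within Y)"
    by (rule diff_chain_within[rotated])
  then show "((\<lambda>y. f (x, y)) has_derivative (\<lambda>h. snd (G (x, y)) \<bullet> h)) (at y within Y)"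
    by (simp add: o_def inner_prod_def)
qed

lemma gradient_on_uminus:
  "gradient_on S f G \<Longrightarrow> gradient_on S (\<lambda>x. - f x) (\<lambda>x. - G x)"
  by (auto simp: gradient_on_def intro!: has_derivative_minus)

text \<open>Half of the constant comes from the gradient inequalities at \<open>z\<close>, which
  bound the right side below by \<open>f (x, ys) - f (xs, y)\<close> plus a quadratic term. The
  other half comes from quadratic growth at the saddle point, which bounds that gap.\<close>

lemma gradient_operator_strongly_monotone_at_saddle:
  assumes "convex_concave_on \<mu> \<mu> X Y f" and "gradient_on (X \<times> Y) f G"
    and "saddle_point X Y f zs" and "z \<in> X \<times> Y"
  shows "\<mu> * (norm (z - zs))\<^sup>2 \<le> gradient_operator G z \<bullet> (z - zs)"
proof -
  obtain x y xs ys where z: "z = (x, y)" and zs: "zs = (xs, ys)"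
    by (metis surj_pair)
  have mem: "x \<in> X" "y \<in> Y" "xs \<in> X" "ys \<in> Y"
    and sad: "\<And>y. y \<in> Y \<Longrightarrow> f (xs, y) \<le> f (xs, ys)" "\<And>x. x \<in> X \<Longrightarrow> f (xs, ys) \<le> f (x, ys)"
    using assms(3,4) by (auto simp: saddle_point_def z zs)
  have cx: "strongly_convex_on \<mu> X (\<lambda>x. f (x, y))" if "y \<in> Y" for y
    using assms(1) that by (simp add: convex_concave_on_def)
  have cy: "strongly_convex_on \<mu> Y (\<lambda>y. - f (x, y))" if "x \<in> X" for x
    using assms(1) that by (simp add: convex_concave_on_def strongly_concave_on_def)
  have "f (x, y) + fst (G z) \<bullet> (xs - x) + \<mu> / 2 * (norm (xs - x))\<^sup>2 \<le> f (xs, y)"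
    using strongly_convex_on_gradient[OF cx gradient_on_partial_fst[OF assms(2)], of y x xs]
      mem by (simp add: z)
  moreover have "- f (x, y) - snd (G z) \<bullet> (ys - y) + \<mu> / 2 * (norm (ys - y))\<^sup>2 \<le> - f (x, ys)"
    using strongly_convex_on_gradient[OF cy gradient_on_uminus[OF gradient_on_partial_snd[OF assms(2)]],
        of x y ys] mem by (simp add: z)
  moreover have "f (xs, ys) + \<mu> / 2 * (norm (x - xs))\<^sup>2 \<le> f (x, ys)"
    using strongly_convex_on_minimum[OF cx, of ys xs x] mem sad by simp
  moreover have "- f (xs, ys) + \<mu> / 2 * (norm (y - ys))\<^sup>2 \<le> - f (xs, y)"
    using strongly_convex_on_minimum[OF cy, of xs ys y] mem sad by simp
  moreover have "(norm (z - zs))\<^sup>2 = (norm (x - xs))\<^sup>2 + (norm (y - ys))\<^sup>2"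
    by (simp add: z zs norm_Pair)
  ultimately show ?thesis
    by (simp add: gradient_operator_def z zs inner_diff_right norm_minus_commute algebra_simps)
qed

lemma gradient_operator_average:
  assumes "convex X" and "convex Y"
    and "\<And>z. z \<in> X \<times> Y \<Longrightarrow> f z = (1 / real n) * (\<Sum>i=1..n. F i z)"
    and "\<And>i. i \<in> {1..n} \<Longrightarrow> gradient_on (X \<times> Y) (F i) (G i)"
    and "gradient_on (X \<times> Y) f Gf"
    and "z \<in> X \<times> Y" and "u \<in> X \<times> Y" and "v \<in> X \<times> Y"
  shows "gradient_operator Gf z \<bullet> (u - v)
    = (1 / real n) * (\<Sum>i=1..n. gradient_operator (G i) z \<bullet> (u - v))"
proof -
  \<comment> \<open>The sign flip is moved onto the direction by swapping the second components of
    \<open>u\<close> and \<open>v\<close>. In a product set the swapped points remain in the domain,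
    so uniqueness on differences applies.\<close>
  have op: "gradient_operator H z \<bullet> (u - v) = H z \<bullet> ((fst u, snd v) - (fst v, snd u))" for H
    by (cases u; cases v) (simp add: gradient_operator_def inner_prod_def inner_diff_right)
  have "gradient_on (X \<times> Y) f (\<lambda>z. (1 / real n) *\<^sub>R (\<Sum>i=1..n. G i z))"
    using assms(3,4) by (intro gradient_on_average)
  from gradient_on_unique[OF assms(5) this convex_Times[OF assms(1,2)] assms(6),
      of "(fst u, snd v)" "(fst v, snd u)"]
  show ?thesis
    using assms(7,8) by (auto simp: op inner_sum_left)
qed

text \<open>Negating the second component is an isometry, so \<open>L\<close> carries over.\<close>

lemma average_smooth_gradient_operator:
  assumes "average_smooth L n S G"
  shows "average_smooth L n S (\<lambda>i. gradient_operator (G i))"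
proof -
  have "norm (gradient_operator H z - gradient_operator H z') = norm (H z - H z')"
    for H :: "'a \<times> 'b \<Rightarrow> 'a \<times> 'b" and z z'
  proof -
    have "norm (- snd (H z) + snd (H z')) = norm (snd (H z) - snd (H z'))"
      by (metis norm_minus_commute uminus_add_conv_diff)
    then show ?thesis
      by (simp add: gradient_operator_def norm_prod_def)
  qed
  with assms show ?thesis
    by (simp add: average_smooth_def)
qed

section \<open>Deterministic inequalities for one step\<close>

lemma extragradient_sample_bound:
  fixes z w zs v d :: "'c::euclidean_space"
  assumes "closed Z" and "convex Z" and "zs \<in> Z"
    and b: "b = (1 - p) *\<^sub>R z + p *\<^sub>R w"
    and h: "h = closest_point Z (b - \<tau> *\<^sub>R v)"
    and zn: "zn = closest_point Z (b - \<tau> *\<^sub>R (v + d))"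
  shows "(norm (zn - zs))\<^sup>2 \<le> (1 - p) * (norm (z - zs))\<^sup>2 + p * (norm (w - zs))\<^sup>2
    - (1 - p) * (norm (h - z))\<^sup>2 - p * (norm (h - w))\<^sup>2
    + \<tau>\<^sup>2 * (norm d)\<^sup>2 + 2 * \<tau> * ((v + d) \<bullet> (zs - h))"
proof -
  \<comment> \<open>The projection onto \<open>h\<close> is tested with \<open>zn\<close>, the
    projection onto \<open>zn\<close> with \<open>zs\<close>. In the sum, the distances from
    \<open>b\<close> expand by convex combination, and their common term in \<open>z - w\<close>
    cancels.\<close>
  have "zn \<in> Z"
    using assms by (auto intro: closest_point_in_set)
  then have "(b - \<tau> *\<^sub>R v - h) \<bullet> (zn - h) \<le> 0"
    unfolding h by (rule closest_point_dot[OF assms(2,1)])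
  moreover have "(b - \<tau> *\<^sub>R (v + d) - zn) \<bullet> (zs - zn) \<le> 0"
    unfolding zn by (rule closest_point_dot[OF assms(2,1,3)])
  \<comment> \<open>Young's inequality for the remaining cross term of \<open>d\<close> with
    \<open>h - zn\<close>; the squared norm of \<open>h - zn\<close> it produces is cancelled by the
    projection inequalities.\<close>
  moreover have "0 \<le> (norm (\<tau> *\<^sub>R d - (h - zn)))\<^sup>2"
    by simp
  ultimately show ?thesis
    unfolding b power2_norm_eq_inner
    by (simp add: inner_simps inner_commute algebra_simps power2_eq_square)
qed

text \<open>The left side is the minimum of the right side over \<open>u\<close>, attained at the
  weighted mean of \<open>x\<close> and \<open>y\<close>. The gap, times \<open>a + b\<close>, is a
  square.\<close>

lemma harmonic_norm_bound:
  fixes u x y :: "'c::real_inner"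
  assumes "a > 0" and "b > 0"
  shows "a * b / (a + b) * (norm (x - y))\<^sup>2 \<le> a * (norm (u - x))\<^sup>2 + b * (norm (u - y))\<^sup>2"
proof -
  have "0 \<le> (norm (a *\<^sub>R (u - x) + b *\<^sub>R (u - y)))\<^sup>2"
    by simp
  also have "\<dots> = (a * (norm (u - x))\<^sup>2 + b * (norm (u - y))\<^sup>2) * (a + b) - a * b * (norm (x - y))\<^sup>2"
    unfolding power2_norm_eq_inner
    by (simp add: inner_simps inner_commute algebra_simps)
  finally show ?thesis
    using assms by (simp add: divide_le_eq)
qed

section \<open>The potential and its conditional expectation\<close>

definition lsvre_potential :: "real \<Rightarrow> 'c::real_normed_vector \<Rightarrow> 'c \<times> 'c \<Rightarrow> real" where
  "lsvre_potential p zs = (\<lambda>(z, w). (1 - p) * (norm (z - zs))\<^sup>2 + (norm (w - zs))\<^sup>2)"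

text \<open>Here \<open>n \<ge> 1\<close> makes \<open>{1..n}\<close> nonempty, so that
  \<open>pmf_of_set\<close> is the uniform law. Finite support later settles integrability.\<close>

lemma finite_set_pmf_lsvre_step:
  assumes "n \<ge> 1"
  shows "finite (set_pmf (lsvre_step Z n g gi \<tau> p s))"
  using assms by (cases s) (auto simp: lsvre_step_def Let_def set_bind_pmf)

lemma set_pmf_lsvre_step:
  assumes "n \<ge> 1" and "closed Z" and "s \<in> Z \<times> Z"
  shows "set_pmf (lsvre_step Z n g gi \<tau> p s) \<subseteq> Z \<times> Z"
  using assms
  by (cases s) (auto simp: lsvre_step_def Let_def set_bind_pmf intro!: closest_point_in_set split: if_splits)

lemma expectation_lsvre_step:
  fixes \<phi> :: "'c::euclidean_space \<times> 'c \<Rightarrow> real"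
  assumes "n \<ge> 1" and "0 \<le> p" and "p \<le> 1"
    and "h = closest_point Z ((1 - p) *\<^sub>R z + p *\<^sub>R w - \<tau> *\<^sub>R g w)"
    and "\<And>i. zn i = closest_point Z ((1 - p) *\<^sub>R z + p *\<^sub>R w - \<tau> *\<^sub>R (g w + (gi i h - gi i w)))"
  shows "measure_pmf.expectation (lsvre_step Z n g gi \<tau> p (z, w)) \<phi>
    = (1 / real n) * (\<Sum>i=1..n. p * \<phi> (zn i, zn i) + (1 - p) * \<phi> (zn i, w))"
proof -
  have "lsvre_step Z n g gi \<tau> p (z, w) = do {
      i \<leftarrow> pmf_of_set {1..n};
      map_pmf (\<lambda>b. (zn i, if b then zn i else w)) (bernoulli_pmf p)}"
    unfolding lsvre_step_def Let_def map_pmf_def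
    by (simp add: assms(4,5) add_diff_eq cong: if_cong)
  moreover have "measure_pmf.expectation (map_pmf (\<lambda>b. (zn i, if b then zn i else w)) (bernoulli_pmf p)) \<phi>
      = p * \<phi> (zn i, zn i) + (1 - p) * \<phi> (zn i, w)" for i
    using assms(2,3) by simp
  ultimately show ?thesis
    using assms(1)
    by (simp add: pmf_expectation_bind[where A = "{1..n}"] sum_distrib_left divide_inverse)
qed

lemma lsvre_step_contraction:
  fixes z w zs :: "'c::euclidean_space"
  assumes "closed Z" and "convex Z" and "z \<in> Z" and "w \<in> Z" and "zs \<in> Z"
    and "n \<ge> 1" and "0 < p" and "p \<le> 1 / 2" and "0 < \<tau>" and "0 < \<mu>"
    and avg: "\<And>v u u'. v \<in> Z \<Longrightarrow> u \<in> Z \<Longrightarrow> u' \<in> Z \<Longrightarrow>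
      g v \<bullet> (u - u') = (1 / real n) * (\<Sum>i=1..n. gi i v \<bullet> (u - u'))"
    and mono: "\<And>v. v \<in> Z \<Longrightarrow> \<mu> * (norm (v - zs))\<^sup>2 \<le> g v \<bullet> (v - zs)"
    and smooth: "average_smooth L n Z gi" and step: "\<tau>\<^sup>2 * L\<^sup>2 \<le> p / 2"
  shows "measure_pmf.expectation (lsvre_step Z n g gi \<tau> p (z, w)) (lsvre_potential p zs)
    \<le> (1 - p * (\<tau> * \<mu>) / (2 * (p + \<tau> * \<mu>))) * lsvre_potential p zs (z, w)"
proof -
  define b where "b = (1 - p) *\<^sub>R z + p *\<^sub>R w"
  define h where "h = closest_point Z (b - \<tau> *\<^sub>R g w)"
  define zn where "zn i = closest_point Z (b - \<tau> *\<^sub>R (g w + (gi i h - gi i w)))" for i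
  define D where "D u = (norm (u - zs))\<^sup>2" for u
  define s where "s = \<tau> * \<mu>"
  define mean where "mean \<phi> = (1 / real n) * (\<Sum>i=1..n. \<phi> i)" for \<phi> :: "nat \<Rightarrow> real"
  have mean_const: "mean (\<lambda>i. c) = c" for c
    using assms(6) by (simp add: mean_def)
  have mean_add: "mean (\<lambda>i. \<phi> i + \<psi> i) = mean \<phi> + mean \<psi>" for \<phi> \<psi>
    by (simp add: mean_def sum.distrib distrib_left)
  have mean_mult: "mean (\<lambda>i. c * \<phi> i) = c * mean \<phi>" for c \<phi>
    by (simp add: mean_def sum_distrib_left[symmetric])
  have mean_mono: "mean \<phi> \<le> mean \<psi>" if "\<And>i. \<phi> i \<le> \<psi> i" for \<phi> \<psi>
    unfolding mean_def by (intro mult_left_mono sum_mono that) auto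
  have hZ: "h \<in> Z"
    unfolding h_def using assms(1,5) by (auto intro: closest_point_in_set)
  have s: "0 < s"
    using assms(9,10) by (simp add: s_def)

  \<comment> \<open>Unbiasedness: \<open>g w\<close> cancels against the mean of
    \<open>gi i w\<close>, leaving \<open>g h\<close>, to which strong monotonicity relative to
    \<open>zs\<close> applies.\<close>
  have "mean (\<lambda>i. (g w + (gi i h - gi i w)) \<bullet> (zs - h))
      = g w \<bullet> (zs - h) + (mean (\<lambda>i. gi i h \<bullet> (zs - h)) + (- 1) * mean (\<lambda>i. gi i w \<bullet> (zs - h)))"
    unfolding mean_mult[symmetric] mean_add[symmetric]
    by (subst mean_const[symmetric], unfold mean_add[symmetric]) (simp add: algebra_simps)
  also have "\<dots> = g h \<bullet> (zs - h)"
    using avg[OF hZ assms(5) hZ] avg[OF assms(4,5) hZ] by (simp add: mean_def)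
  also have "\<dots> \<le> - \<mu> * D h"
    using mono[OF hZ] by (simp add: D_def inner_diff_right)
  finally have drift: "2 * \<tau> * mean (\<lambda>i. (g w + (gi i h - gi i w)) \<bullet> (zs - h)) \<le> 2 * \<tau> * (- \<mu> * D h)"
    using assms(9) by (intro mult_left_mono) auto

  \<comment> \<open>The variance uses up only half of the available multiple \<open>p\<close> of the
    squared norm of \<open>h - w\<close>; the other half is kept to recover
    \<open>D w\<close>.\<close>
  have "\<tau>\<^sup>2 * mean (\<lambda>i. (norm (gi i h - gi i w))\<^sup>2) \<le> \<tau>\<^sup>2 * (L\<^sup>2 * (norm (h - w))\<^sup>2)"
    using smooth hZ assms(4) by (intro mult_left_mono) (auto simp: average_smooth_def mean_def)
  also have "\<dots> \<le> p / 2 * (norm (h - w))\<^sup>2"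
    using mult_right_mono[OF step, of "(norm (h - w))\<^sup>2"] by (simp add: mult.assoc)
  finally have var: "\<tau>\<^sup>2 * mean (\<lambda>i. (norm (gi i h - gi i w))\<^sup>2) \<le> p / 2 * (norm (h - w))\<^sup>2" .

  have "mean (\<lambda>i. D (zn i)) \<le> mean (\<lambda>i. ((1 - p) * D z + p * D w
      - (1 - p) * (norm (h - z))\<^sup>2 - p * (norm (h - w))\<^sup>2)
      + (\<tau>\<^sup>2 * (norm (gi i h - gi i w))\<^sup>2 + (2 * \<tau>) * ((g w + (gi i h - gi i w)) \<bullet> (zs - h))))"
    unfolding D_def
    using extragradient_sample_bound[OF assms(1,2,5) b_def h_def zn_def]
    by (intro mean_mono) (simp add: add.assoc)
  also have "\<dots> \<le> (1 - p) * D z + p * D w - (1 - p) * (norm (h - z))\<^sup>2 - p / 2 * (norm (h - w))\<^sup>2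
      - 2 * s * D h"
    unfolding mean_add mean_mult mean_const using drift var by (simp add: s_def algebra_simps)
  finally have D: "mean (\<lambda>i. D (zn i)) \<le> \<dots>" .

  \<comment> \<open>One copy of \<open>s * D h\<close> recovers \<open>D z\<close> from \<open>h - z\<close>, the other recovers \<open>D w\<close> from \<open>h - w\<close>.\<close>
  have "p * s / (2 * (p + s)) \<le> p * s / (p + 2 * s)"
    using assms(7) s by (intro divide_left_mono) auto
  also have "\<dots> = (p / 2) * s / (p / 2 + s)"
    using assms(7) s by (simp add: field_simps)
  finally have r1: "p * s / (2 * (p + s)) \<le> \<dots>" .
  \<comment> \<open>\<open>r1\<close> and \<open>r2\<close> compare the rate with the coefficients
    of \<open>harmonic_norm_bound\<close> for the weight pairs \<open>p / 2\<close>,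
    \<open>s\<close> and \<open>1 - p\<close>, \<open>s\<close>. The second comparison rests on
    \<open>p \<le> 1 - p\<close>.\<close>
  have "p * (1 - p + s) \<le> (1 - p) * (1 - p + s)" and "p * s \<le> (1 - p) * s"
    using assms(7,8) s by (auto intro!: mult_right_mono)
  moreover have "0 \<le> (1 - p) * p" and "0 \<le> (1 - p) * s"
    using assms(7,8) s by auto
  ultimately have "p * (1 - p + s) \<le> (1 - p) * (2 * (p + s))"
    by (simp add: algebra_simps)
  then have "s * (p * (1 - p + s)) \<le> s * ((1 - p) * (2 * (p + s)))"
    using s by (intro mult_left_mono) auto
  then have r2: "p * s / (2 * (p + s)) \<le> (1 - p) * s / (1 - p + s)"
    using assms(7,8) s by (simp add: pos_divide_le_eq ac_simps) (simp add: pos_le_divide_eq ac_simps)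
  have "p * s / (2 * (p + s)) * D w \<le> (p / 2) * s / (p / 2 + s) * D w"
    using r1 by (intro mult_right_mono) (auto simp: D_def)
  also have "\<dots> \<le> p / 2 * (norm (h - w))\<^sup>2 + s * D h"
    unfolding D_def using assms(7) s by (intro harmonic_norm_bound) auto
  finally have w: "p * s / (2 * (p + s)) * D w \<le> \<dots>" .
  have "p * s / (2 * (p + s)) * ((1 - p) * D z) \<le> p * s / (2 * (p + s)) * D z"
    using assms(7,8) s by (intro mult_left_mono mult_left_le_one_le) (auto simp: D_def)
  also have "\<dots> \<le> (1 - p) * s / (1 - p + s) * D z"
    using r2 by (intro mult_right_mono) (auto simp: D_def)
  also have "\<dots> \<le> (1 - p) * (norm (h - z))\<^sup>2 + s * D h"
    unfolding D_def using assms(7,8) s by (intro harmonic_norm_bound) auto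
  finally have z: "p * s / (2 * (p + s)) * ((1 - p) * D z) \<le> \<dots>" .

  have "measure_pmf.expectation (lsvre_step Z n g gi \<tau> p (z, w)) (lsvre_potential p zs)
      = mean (\<lambda>i. p * lsvre_potential p zs (zn i, zn i) + (1 - p) * lsvre_potential p zs (zn i, w))"
    unfolding mean_def
    using assms(6-8)
    by (intro expectation_lsvre_step[where h = h and zn = zn]) (auto simp: h_def zn_def b_def)
  \<comment> \<open>This explains the weight \<open>1 - p\<close> in the potential: the refresh of
    \<open>w\<close> contributes \<open>p * D (zn i)\<close>, completing the coefficient to 1. The
    leftover \<open>(1 - p) * D w\<close> joins the \<open>p * D w\<close> of the step bound to give
    the old weight of \<open>D w\<close>.\<close>
  also have "\<dots> = mean (\<lambda>i. D (zn i) + (1 - p) * D w)"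
    by (simp add: lsvre_potential_def D_def algebra_simps)
  also have "\<dots> = mean (\<lambda>i. D (zn i)) + (1 - p) * D w"
    unfolding mean_add mean_const ..
  also have "\<dots> \<le> ((1 - p) * D z + D w) - p * s / (2 * (p + s)) * ((1 - p) * D z) - p * s / (2 * (p + s)) * D w"
    using D w z by (simp add: algebra_simps)
  also have "\<dots> = (1 - p * s / (2 * (p + s))) * ((1 - p) * D z + D w)"
    by (simp only: left_diff_distrib[of 1] distrib_left mult_1 diff_diff_eq)
  finally show ?thesis
    by (simp add: lsvre_potential_def D_def s_def)
qed

section \<open>Iterating the kernel\<close>

lemma set_pmf_lsvre:
  assumes "n \<ge> 1" and "closed Z" and "z0 \<in> Z"
  shows "finite (set_pmf (lsvre Z n g gi \<tau> p z0 k)) \<and> set_pmf (lsvre Z n g gi \<tau> p z0 k) \<subseteq> Z \<times> Z"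
proof (induction k)
  case (Suc k)
  then show ?case
    using finite_set_pmf_lsvre_step[OF assms(1), of Z g gi \<tau> p] set_pmf_lsvre_step[OF assms(1,2), of _ g gi \<tau> p]
    by (auto simp: set_bind_pmf) blast+
qed (use assms in auto)

text \<open>The last step is split off by conditioning, which is a finite sum here. The contraction
  is only assumed on \<open>Z \<times> Z\<close>, hence the support invariant;
  \<open>0 \<le> c\<close> lets the induction hypothesis be multiplied by \<open>c\<close>.\<close>

lemma expectation_lsvre_le:
  fixes \<phi> :: "'c::euclidean_space \<times> 'c \<Rightarrow> real"
  assumes "n \<ge> 1" and "closed Z" and "z0 \<in> Z" and "0 \<le> c"
    and "\<And>s. s \<in> Z \<times> Z \<Longrightarrow> measure_pmf.expectation (lsvre_step Z n g gi \<tau> p s) \<phi> \<le> c * \<phi> s"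
  shows "measure_pmf.expectation (lsvre Z n g gi \<tau> p z0 k) \<phi> \<le> c ^ k * \<phi> (z0, z0)"
proof (induction k)
  case (Suc k)
  let ?P = "lsvre Z n g gi \<tau> p z0 k"
  have fin: "finite (set_pmf ?P)" and sub: "set_pmf ?P \<subseteq> Z \<times> Z"
    using set_pmf_lsvre[OF assms(1-3), of g gi \<tau> p k] by auto
  have "measure_pmf.expectation (lsvre Z n g gi \<tau> p z0 (Suc k)) \<phi>
      = (\<Sum>s\<in>set_pmf ?P. pmf ?P s *\<^sub>R measure_pmf.expectation (lsvre_step Z n g gi \<tau> p s) \<phi>)"
    unfolding lsvre.simps
    by (intro pmf_expectation_bind fin finite_set_pmf_lsvre_step assms(1) order_refl)
  also have "\<dots> \<le> (\<Sum>s\<in>set_pmf ?P. pmf ?P s *\<^sub>R (c * \<phi> s))"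
    using assms(5) sub by (intro sum_mono scaleR_left_mono) auto
  also have "\<dots> = c * measure_pmf.expectation ?P \<phi>"
    by (simp add: integral_measure_pmf[OF fin] sum_distrib_left ac_simps)
  also have "\<dots> \<le> c * (c ^ k * \<phi> (z0, z0))"
    using Suc assms(4) by (intro mult_left_mono)
  finally show ?case
    by (simp add: ac_simps)
qed simp

section \<open>The rate for the prescribed parameters\<close>

theorem theorem2:
  fixes X :: "'a::euclidean_space set" and Y :: "'b::euclidean_space set"
    and n :: nat
    and F :: "nat \<Rightarrow> 'a \<times> 'b \<Rightarrow> real" and f :: "'a \<times> 'b \<Rightarrow> real"
    and G :: "nat \<Rightarrow> 'a \<times> 'b \<Rightarrow> 'a \<times> 'b" and Gf :: "'a \<times> 'b \<Rightarrow> 'a \<times> 'b"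
    and \<mu> L \<tau> p :: real and zstar z0 :: "'a \<times> 'b" and k :: nat
  assumes "closed X" and "convex X" and "closed Y" and "convex Y"
    and "n \<ge> 1"
    and "\<And>z. z \<in> X \<times> Y \<Longrightarrow> f z = (1 / real n) * (\<Sum>i=1..n. F i z)"
    and "\<And>i. i \<in> {1..n} \<Longrightarrow> gradient_on (X \<times> Y) (F i) (G i)"
    and "gradient_on (X \<times> Y) f Gf"
    and "\<And>i y. i \<in> {1..n} \<Longrightarrow> y \<in> Y \<Longrightarrow> convex_on X (\<lambda>x. F i (x, y))"
    and "\<And>i x. i \<in> {1..n} \<Longrightarrow> x \<in> X \<Longrightarrow> concave_on Y (\<lambda>y. F i (x, y))"
    and "\<mu> > 0" and "convex_concave_on \<mu> \<mu> X Y f"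
    and "L > 0" and "average_smooth L n (X \<times> Y) G"
    and "saddle_point X Y f zstar"
    and "z0 \<in> X \<times> Y"
    and "p = 1 / (2 * real n)" and "\<tau> = 1 / (4 * sqrt (real n) * L)"
  shows "measure_pmf.expectation
           (lsvre (X \<times> Y) n (gradient_operator Gf) (\<lambda>i. gradient_operator (G i)) \<tau> p z0 k)
           (\<lambda>(z, w). (norm (z - zstar))\<^sup>2)
         \<le> 4 * (norm (z0 - zstar))\<^sup>2 *
            (1 - 1 / (4 * (real n + 2 * sqrt (real n) * L / \<mu>))) ^ k"
proof -
  let ?Z = "X \<times> Y" and ?g = "gradient_operator Gf" and ?gi = "\<lambda>i. gradient_operator (G i)"
  let ?c = "1 - p * (\<tau> * \<mu>) / (2 * (p + \<tau> * \<mu>))"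
  let ?P = "lsvre ?Z n ?g ?gi \<tau> p z0 k"
  have Z: "closed ?Z" "convex ?Z" "zstar \<in> ?Z"
    using assms(1-4,15) by (auto simp: saddle_point_def intro: closed_Times convex_Times)
  have p: "0 < p" "p \<le> 1 / 2" and \<tau>: "0 < \<tau>"
    using assms(5,13) by (auto simp: assms(17,18))
  \<comment> \<open>The left side is \<open>1 / (16 * n)\<close>, the right side
    \<open>1 / (4 * n)\<close>.\<close>
  have step: "\<tau>\<^sup>2 * L\<^sup>2 \<le> p / 2"
    using assms(5,13) by (simp add: assms(17,18) power_divide power_mult_distrib field_simps)
  \<comment> \<open>The rate is written through reciprocals so that the two summands become
    \<open>n\<close> and \<open>2 * sqrt n * L / \<mu>\<close>.\<close>
  have "4 * (1 / (2 * p) + 1 / (2 * (\<tau> * \<mu>))) = 2 * (p + \<tau> * \<mu>) / (p * (\<tau> * \<mu>))"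
    using p \<tau> assms(11) by (simp add: field_simps)
  then have "1 / (4 * (1 / (2 * p) + 1 / (2 * (\<tau> * \<mu>)))) = p * (\<tau> * \<mu>) / (2 * (p + \<tau> * \<mu>))"
    by (simp only: divide_divide_eq_right mult_1)
  moreover have "1 / (2 * p) = real n" and "1 / (2 * (\<tau> * \<mu>)) = 2 * sqrt (real n) * L / \<mu>"
    by (simp_all add: assms(17,18))
  ultimately have c: "?c = 1 - 1 / (4 * (real n + 2 * sqrt (real n) * L / \<mu>))"
    by (simp only:)
  have "1 \<le> 4 * (real n + 2 * sqrt (real n) * L / \<mu>)"
    using assms(5,11,13) by (auto intro!: add_increasing2 simp: distrib_left)
  then have c0: "0 \<le> ?c"
    unfolding c by (simp add: divide_le_eq)

  have "measure_pmf.expectation (lsvre_step ?Z n ?g ?gi \<tau> p s) (lsvre_potential p zstar)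
      \<le> ?c * lsvre_potential p zstar s" if sZ: "s \<in> ?Z \<times> ?Z" for s
  proof -
    obtain z w where s: "s = (z, w)" "z \<in> ?Z" "w \<in> ?Z"
      using sZ by (rule SigmaE)
    show ?thesis
      unfolding s(1)
      by (rule lsvre_step_contraction[OF Z(1,2) s(2,3) Z(3) assms(5) p \<tau> assms(11)
            gradient_operator_average[OF assms(2,4,6,7,8)]
            gradient_operator_strongly_monotone_at_saddle[OF assms(12,8,15)]
            average_smooth_gradient_operator[OF assms(14)] step])
  qed
  then have pot: "measure_pmf.expectation ?P (lsvre_potential p zstar)
      \<le> ?c ^ k * lsvre_potential p zstar (z0, z0)"
    by (rule expectation_lsvre_le[OF assms(5) Z(1) assms(16) c0])
  have int: "integrable (measure_pmf ?P) \<phi>" for \<phi> :: "('a \<times> 'b) \<times> 'a \<times> 'b \<Rightarrow> real"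
    using set_pmf_lsvre[OF assms(5) Z(1) assms(16)] by (intro integrable_measure_pmf_finite) auto
  \<comment> \<open>Dropping the nonnegative \<open>w\<close> term of the potential leaves the
    factor \<open>1 - p > 0\<close>, which cancels at the end.\<close>
  have "(1 - p) * measure_pmf.expectation ?P (\<lambda>(z, w). (norm (z - zstar))\<^sup>2)
      = measure_pmf.expectation ?P (\<lambda>s. (1 - p) * (case s of (z, w) \<Rightarrow> (norm (z - zstar))\<^sup>2))"
    by simp
  also have "\<dots> \<le> measure_pmf.expectation ?P (lsvre_potential p zstar)"
    by (intro integral_mono int) (auto simp: lsvre_potential_def)
  also note pot
  also have "lsvre_potential p zstar (z0, z0) = (2 - p) * (norm (z0 - zstar))\<^sup>2"
    by (simp add: lsvre_potential_def algebra_simps)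
  also have "?c ^ k * \<dots> \<le> ?c ^ k * ((1 - p) * 4 * (norm (z0 - zstar))\<^sup>2)"
    using p c0 by (intro mult_left_mono mult_right_mono) auto
  also have "\<dots> = (1 - p) * (4 * (norm (z0 - zstar))\<^sup>2 * ?c ^ k)"
    by (simp add: ac_simps)
  finally show ?thesis
    using p unfolding c by simp
qed

end
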